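(* Let $\theta,\rho\in\mathbb{R}$ with $|\theta|<1$, $|\rho|<1$, let $(V_n)_{n\ge1}$ be a sequence of square-integrable, independent and identically distributed real random variables with zero mean and variance $\sigma^2>0$, let the initial values $X_0,\varepsilon_0$ be arbitrary, and for all $n\ge1$ let $X_n=\theta X_{n-1}+\varepsilon_n$ and $\varepsilon_n=\rho\varepsilon_{n-1}+V_n$. Let $$\widehat{\theta}_n=\frac{\sum_{k=1}^n X_kX_{k-1}}{\sum_{k=1}^n X_{k-1}^2}.$$ Then $$\lim_{n\to\infty}\widehat{\theta}_n=\theta^*\quad\text{almost surely},\qquad\text{where } \theta^*=\frac{\theta+\rho}{1+\theta\rho}.$$
   Context: $\widehat\theta_n$ is the least squares estimator of $\theta$, i.e. the minimizer of $t\mapsto\sum_{k=1}^n(X_k-tX_{k-1})^2$. Convention: a quotient defining an estimator is read as $0$ if its denominator vanishes. *)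

theory Defs
  imports "HOL-Probability.Probability"
begin

text \<open>
  The least squares estimator along one trajectory \<open>x 0, x 1, \<dots>\<close>. Division by zero is zero,
  so the value is \<open>0\<close> when the denominator vanishes.
\<close>
definition ls_estimator :: "(nat \<Rightarrow> real) \<Rightarrow> nat \<Rightarrow> real" where
  "ls_estimator x n = (\<Sum>k=1..n. x k * x (k - 1)) / (\<Sum>k=1..n. (x (k - 1))\<^sup>2)"

definition iid_from_1 :: "'a measure \<Rightarrow> (nat \<Rightarrow> 'a \<Rightarrow> real) \<Rightarrow> bool" where
  "iid_from_1 M V \<longleftrightarrow>
     prob_space.indep_vars M (\<lambda>_. borel) V {1..} \<and>
     (\<forall>n\<ge>1. distr M borel (V n) = distr M borel (V 1))"

end

theory Submission
  imports Defs "HOL-Library.Discrete_Functions"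
begin

text \<open>
  Write \<open>N\<^sub>n\<close> and \<open>D\<^sub>n\<close> for the numerator and the denominator of the estimator. Eliminating the noise
  \<open>\<epsilon>\<close> shows that \<open>X\<close> is autoregressive of order two with innovations \<open>V\<close>. Multiplying that recursion
  by \<open>X\<^sub>k\<^sub>-\<^sub>1\<close> and summing makes the lag-two products telescope back into \<open>N\<^sub>n\<close>, which gives the exact
  identity \<open>(1 + \<theta>\<rho>) N\<^sub>n = (\<theta> + \<rho>) D\<^sub>n + R\<^sub>n\<close>, where \<open>R\<^sub>n\<close> is \<open>\<Sum> X\<^sub>k\<^sub>-\<^sub>1 V\<^sub>k\<close> plus boundary terms
  (lemma \<open>ls_normal_equation\<close>). So the claim is equivalent to \<open>R\<^sub>n / D\<^sub>n \<longlongrightarrow> 0\<close>, and it suffices that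
  almost surely \<open>R\<^sub>n = o(n)\<close> while \<open>D\<^sub>n\<close> grows at least linearly. Three facts give this (lemma
  \<open>ls_estimator_tendsto\<close>).

  First, \<open>V\<^sub>n\<^sup>2 / n \<longlongrightarrow> 0\<close>, by the first Borel-Cantelli lemma. Stability of the two recursions carries
  this over to \<open>\<epsilon>\<^sub>n\<^sup>2 / n\<close> and \<open>X\<^sub>n\<^sup>2 / n\<close>, which settles the boundary terms.

  Second, \<open>\<Sum> X\<^sub>k\<^sub>-\<^sub>1 V\<^sub>k = o(n)\<close>. This rests on a strong law for orthogonal sequences with bounded second
  moments (\<open>AE_average_orthogonal_tendsto_0\<close>), which applies to \<open>Y\<^sub>k\<^sub>-\<^sub>1 V\<^sub>k\<close> whenever \<open>Y\<^sub>k\<^sub>-\<^sub>1\<close> is a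
  function of \<open>V\<^sub>1, \<dots>, V\<^sub>k\<^sub>-\<^sub>1\<close> (\<open>AE_average_predictable_tendsto_0\<close>). The arbitrary initial values may
  depend on all of \<open>V\<close>, but \<open>X\<close> is linear in them: it is the process started at zero plus \<open>X\<^sub>0\<close> and
  \<open>\<epsilon>\<^sub>0\<close> times bounded deterministic sequences. Each of the three pieces has predictable coefficients,
  and the two random factors are constants along a trajectory.

  Third, \<open>D\<^sub>n\<close> dominates a fixed multiple of \<open>\<Sum> V\<^sub>k\<^sup>2\<close> up to boundary terms, because each \<open>V\<^sub>k\<close> is a
  bounded combination of three consecutive values of \<open>X\<close>. The squares \<open>V\<^sub>k\<^sup>2\<close> have only a first moment,
  but for a lower bound they may be truncated at \<open>1\<close>: the truncated squares are
  bounded, the same orthogonal strong law applies to them, and their mean is positive since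
  \<open>\<sigma>\<^sup>2 > 0\<close>.
\<close>

section \<open>A strong law for orthogonal sequences\<close>

text \<open>
  By monotone convergence the random series \<open>\<Sum>n. f n \<omega>\<close> has finite expectation, so it converges
  almost surely and its terms vanish in the limit.
\<close>
lemma AE_tendsto_0_of_summable_expectation:
  fixes f :: "nat \<Rightarrow> 'a \<Rightarrow> real"
  assumes int: "\<And>n. integrable M (f n)"
    and nonneg: "\<And>n \<omega>. 0 \<le> f n \<omega>"
    and sum: "summable (\<lambda>n. integral\<^sup>L M (f n))"
  shows "AE \<omega> in M. (\<lambda>n. f n \<omega>) \<longlonglongrightarrow> 0"
proof -
  have [measurable]: "f n \<in> borel_measurable M" for n
    using int by auto
  have "(\<integral>\<^sup>+\<omega>. (\<Sum>n. ennreal (f n \<omega>)) \<partial>M) = (\<Sum>n. \<integral>\<^sup>+\<omega>. ennreal (f n \<omega>) \<partial>M)"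
    by (rule nn_integral_suminf) simp
  also have "\<dots> = (\<Sum>n. ennreal (integral\<^sup>L M (f n)))"
    by (simp add: nn_integral_eq_integral int nonneg)
  also have "\<dots> = ennreal (\<Sum>n. integral\<^sup>L M (f n))"
    by (rule suminf_ennreal2) (simp_all add: sum nonneg)
  finally have "(\<integral>\<^sup>+\<omega>. (\<Sum>n. ennreal (f n \<omega>)) \<partial>M) \<noteq> \<infinity>"
    by simp
  then have "AE \<omega> in M. (\<Sum>n. ennreal (f n \<omega>)) \<noteq> \<infinity>"
    by (intro nn_integral_PInf_AE) measurable
  then show ?thesis
    by eventually_elim (auto intro!: summable_LIMSEQ_zero summable_suminf_not_top nonneg)
qed

lemma integrable_mult_of_square_integrable:
  fixes f g :: "'a \<Rightarrow> real"
  assumes [measurable]: "f \<in> borel_measurable M" "g \<in> borel_measurable M"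
    and f: "integrable M (\<lambda>\<omega>. (f \<omega>)\<^sup>2)" and g: "integrable M (\<lambda>\<omega>. (g \<omega>)\<^sup>2)"
  shows "integrable M (\<lambda>\<omega>. f \<omega> * g \<omega>)"
proof (rule Bochner_Integration.integrable_bound[OF Bochner_Integration.integrable_add[OF f g]])
  show "AE \<omega> in M. norm (f \<omega> * g \<omega>) \<le> norm ((f \<omega>)\<^sup>2 + (g \<omega>)\<^sup>2)"
  proof (rule AE_I2)
    fix \<omega>
    have "0 \<le> (\<bar>f \<omega>\<bar> - \<bar>g \<omega>\<bar>)\<^sup>2" "0 \<le> \<bar>f \<omega>\<bar> * \<bar>g \<omega>\<bar>" by simp_all
    then show "norm (f \<omega> * g \<omega>) \<le> norm ((f \<omega>)\<^sup>2 + (g \<omega>)\<^sup>2)"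
      unfolding power2_diff power2_abs real_norm_def abs_mult by linarith
  qed
qed measurable

text \<open>
  Expanding the square, orthogonality removes every mixed term.
\<close>
lemma expectation_orthogonal_sum_square_le:
  fixes D :: "'i \<Rightarrow> 'a \<Rightarrow> real"
  assumes fin: "finite A"
    and meas: "\<And>k. k \<in> A \<Longrightarrow> D k \<in> borel_measurable M"
    and int: "\<And>k. k \<in> A \<Longrightarrow> integrable M (\<lambda>\<omega>. (D k \<omega>)\<^sup>2)"
    and le: "\<And>k. k \<in> A \<Longrightarrow> (\<integral>\<omega>. (D k \<omega>)\<^sup>2 \<partial>M) \<le> C"
    and orth: "\<And>j k. j \<in> A \<Longrightarrow> k \<in> A \<Longrightarrow> j \<noteq> k \<Longrightarrow> (\<integral>\<omega>. D j \<omega> * D k \<omega> \<partial>M) = 0"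
  shows "integrable M (\<lambda>\<omega>. (\<Sum>k\<in>A. D k \<omega>)\<^sup>2)"
    and "(\<integral>\<omega>. (\<Sum>k\<in>A. D k \<omega>)\<^sup>2 \<partial>M) \<le> C * card A"
proof -
  have eq: "(\<Sum>k\<in>A. D k \<omega>)\<^sup>2 = (\<Sum>j\<in>A. \<Sum>k\<in>A. D j \<omega> * D k \<omega>)" for \<omega>
    by (simp add: power2_eq_square sum_product)
  have prod: "integrable M (\<lambda>\<omega>. D j \<omega> * D k \<omega>)" if "j \<in> A" "k \<in> A" for j k
    using that by (intro integrable_mult_of_square_integrable meas int)
  show "integrable M (\<lambda>\<omega>. (\<Sum>k\<in>A. D k \<omega>)\<^sup>2)"
    unfolding eq by (intro Bochner_Integration.integrable_sum prod)
  have "(\<integral>\<omega>. (\<Sum>k\<in>A. D k \<omega>)\<^sup>2 \<partial>M) = (\<Sum>j\<in>A. \<Sum>k\<in>A. \<integral>\<omega>. D j \<omega> * D k \<omega> \<partial>M)"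
    unfolding eq by (simp add: Bochner_Integration.integral_sum prod)
  also have "\<dots> = (\<Sum>j\<in>A. \<Sum>k\<in>A. if k = j then \<integral>\<omega>. (D j \<omega>)\<^sup>2 \<partial>M else 0)"
    by (intro sum.cong refl) (auto simp: orth power2_eq_square)
  also have "\<dots> = (\<Sum>j\<in>A. \<integral>\<omega>. (D j \<omega>)\<^sup>2 \<partial>M)"
    by (simp add: sum.delta fin)
  also have "\<dots> \<le> (\<Sum>j\<in>A. C)"
    by (intro sum_mono le)
  finally show "(\<integral>\<omega>. (\<Sum>k\<in>A. D k \<omega>)\<^sup>2 \<partial>M) \<le> C * card A"
    by (simp add: mult.commute)
qed

lemma filterlim_floor_sqrt: "filterlim floor_sqrt at_top at_top"
  unfolding filterlim_at_top
proof
  fix z :: nat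
  show "\<forall>\<^sub>F n in sequentially. z \<le> floor_sqrt n"
    using eventually_ge_at_top[of "z\<^sup>2"] by eventually_elim (rule le_floor_sqrtI)
qed

text \<open>
  The averages along the squares control all averages, provided that the oscillation of \<open>S\<close> between
  consecutive squares is small. For \<open>q\<^sup>2 \<le> n < (q + 1)\<^sup>2\<close> the oscillation at \<open>n\<close> is bounded by the sum of
  squares over the whole block. The sum is a crude bound for the maximum over the block,
  but its expectation can be read off from second moments of increments.
\<close>
lemma tendsto_0_along_squares:
  fixes S :: "nat \<Rightarrow> real"
  assumes squares: "(\<lambda>q. (S (q\<^sup>2))\<^sup>2 / real q ^ 4) \<longlonglongrightarrow> 0"
    and blocks: "(\<lambda>q. (\<Sum>m\<in>{q\<^sup>2..<(Suc q)\<^sup>2}. (S m - S (q\<^sup>2))\<^sup>2) / real q ^ 4) \<longlonglongrightarrow> 0"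
  shows "(\<lambda>n. S n / real n) \<longlonglongrightarrow> 0"
proof -
  define B where "B q = 2 * ((S (q\<^sup>2))\<^sup>2 / real q ^ 4)
    + 2 * ((\<Sum>m\<in>{q\<^sup>2..<(Suc q)\<^sup>2}. (S m - S (q\<^sup>2))\<^sup>2) / real q ^ 4)" for q
  have "B \<longlonglongrightarrow> 0"
    unfolding B_def using tendsto_add[OF tendsto_mult[OF tendsto_const squares] tendsto_mult[OF tendsto_const blocks]]
    by simp
  then have lim: "(\<lambda>n. B (floor_sqrt n)) \<longlonglongrightarrow> 0"
    by (rule filterlim_compose[OF _ filterlim_floor_sqrt])
  have bound: "(S n / real n)\<^sup>2 \<le> B (floor_sqrt n)" if "n > 0" for n
  proof -
    define q where "q = floor_sqrt n"
    have q: "q\<^sup>2 \<le> n" "n < (Suc q)\<^sup>2" "q > 0"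
      using that unfolding q_def by (auto simp: Suc_floor_sqrt_power2_gt)
    have "real q ^ 4 = (real (q\<^sup>2))\<^sup>2" by simp
    also have "\<dots> \<le> (real n)\<^sup>2"
      using q by (intro power_mono) (simp_all only: of_nat_le_iff of_nat_0_le_iff)
    finally have "(S n)\<^sup>2 / (real n)\<^sup>2 \<le> (S n)\<^sup>2 / real q ^ 4"
      using q that by (intro divide_left_mono mult_pos_pos) auto
    moreover have "(S n)\<^sup>2 \<le> 2 * (S (q\<^sup>2))\<^sup>2 + 2 * (S n - S (q\<^sup>2))\<^sup>2"
      using sum_squares_bound[of "S (q\<^sup>2)" "S n - S (q\<^sup>2)"]
      by (simp add: power2_eq_square algebra_simps)
    moreover have "(S n - S (q\<^sup>2))\<^sup>2 \<le> (\<Sum>m\<in>{q\<^sup>2..<(Suc q)\<^sup>2}. (S m - S (q\<^sup>2))\<^sup>2)"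
      using q by (intro member_le_sum) auto
    ultimately have "(S n)\<^sup>2 / (real n)\<^sup>2
      \<le> (2 * (S (q\<^sup>2))\<^sup>2 + 2 * (\<Sum>m\<in>{q\<^sup>2..<(Suc q)\<^sup>2}. (S m - S (q\<^sup>2))\<^sup>2)) / real q ^ 4"
      by (smt (verit) divide_right_mono zero_le_power of_nat_0_le_iff)
    then show ?thesis
      unfolding B_def q_def[symmetric] by (simp add: power_divide add_divide_distrib)
  qed
  have "(\<lambda>n. (S n / real n)\<^sup>2) \<longlonglongrightarrow> 0"
    by (rule tendsto_sandwich[OF _ _ tendsto_const lim])
      (auto intro!: eventually_mono[OF eventually_gt_at_top[of 0] bound])
  then have "(\<lambda>n. sqrt ((S n / real n)\<^sup>2)) \<longlonglongrightarrow> sqrt 0"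
    by (rule tendsto_real_sqrt)
  then show ?thesis
    unfolding real_sqrt_abs real_sqrt_zero tendsto_rabs_zero_iff .
qed

text \<open>
  The second moment of the average over \<open>n\<close> terms is \<open>O(1/n)\<close>, which is not summable, but along the
  squares it is \<open>O(1/q\<^sup>2)\<close>. Between \<open>q\<^sup>2\<close> and \<open>(q + 1)\<^sup>2\<close> there are \<open>2 q + 1\<close> indices, and each
  increment from \<open>q\<^sup>2\<close> has second moment \<open>O(q)\<close>. Hence the block sum of squares, divided by \<open>q\<^sup>4\<close>, again
  has expectation \<open>O(1/q\<^sup>2)\<close>. Both sequences tend to \<open>0\<close> almost surely, and
  \<open>tendsto_0_along_squares\<close> combines them.
\<close>
lemma AE_average_orthogonal_tendsto_0:
  fixes D :: "nat \<Rightarrow> 'a \<Rightarrow> real"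
  assumes meas: "\<And>k. k \<ge> 1 \<Longrightarrow> D k \<in> borel_measurable M"
    and int: "\<And>k. k \<ge> 1 \<Longrightarrow> integrable M (\<lambda>\<omega>. (D k \<omega>)\<^sup>2)"
    and le: "\<And>k. k \<ge> 1 \<Longrightarrow> (\<integral>\<omega>. (D k \<omega>)\<^sup>2 \<partial>M) \<le> C"
    and orth: "\<And>j k. 1 \<le> j \<Longrightarrow> j < k \<Longrightarrow> (\<integral>\<omega>. D j \<omega> * D k \<omega> \<partial>M) = 0"
  shows "AE \<omega> in M. (\<lambda>n. (\<Sum>k=1..n. D k \<omega>) / real n) \<longlonglongrightarrow> 0"
proof -
  define S where "S n \<omega> = (\<Sum>k=1..n. D k \<omega>)" for n \<omega>
  have orth': "(\<integral>\<omega>. D j \<omega> * D k \<omega> \<partial>M) = 0" if "1 \<le> j" "1 \<le> k" "j \<noteq> k" for j k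
    using that orth[of j k] orth[of k j] by (cases "j < k") (auto simp: mult.commute)
  have C: "0 \<le> C"
    by (rule order_trans[OF Bochner_Integration.integral_nonneg le[of 1]]) simp_all
  have incr: "S m \<omega> - S l \<omega> = (\<Sum>k\<in>{l<..m}. D k \<omega>)" if "l \<le> m" for l m \<omega>
  proof -
    have "{1..m} = {1..l} \<union> {l<..m}" using that by auto
    then show ?thesis
      unfolding S_def by (subst \<open>{1..m} = _\<close>, subst sum.union_disjoint) auto
  qed
  have diff_int: "integrable M (\<lambda>\<omega>. (S m \<omega> - S l \<omega>)\<^sup>2)"
    and diff_le: "(\<integral>\<omega>. (S m \<omega> - S l \<omega>)\<^sup>2 \<partial>M) \<le> C * real (m - l)" if "l \<le> m" for l m
    unfolding incr[OF that]
    using expectation_orthogonal_sum_square_le[of "{l<..m}" D M C] meas int le orth'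
    by auto
  have S0: "S 0 \<omega> = 0" for \<omega> by (simp add: S_def)

  have "AE \<omega> in M. (\<lambda>q. (S (q\<^sup>2) \<omega>)\<^sup>2 / real q ^ 4) \<longlonglongrightarrow> 0"
  proof (rule AE_tendsto_0_of_summable_expectation)
    show "integrable M (\<lambda>\<omega>. (S (q\<^sup>2) \<omega>)\<^sup>2 / real q ^ 4)" for q
      using diff_int[of 0 "q\<^sup>2"] by (simp add: S0)
    have "summable (\<lambda>q. C * inverse (real q ^ 2))"
      by (intro summable_mult inverse_power_summable) simp
    then show "summable (\<lambda>q. \<integral>\<omega>. (S (q\<^sup>2) \<omega>)\<^sup>2 / real q ^ 4 \<partial>M)"
    proof (rule summable_comparison_test')
      fix q :: nat assume "q \<ge> 1"
      have "(\<integral>\<omega>. (S (q\<^sup>2) \<omega>)\<^sup>2 \<partial>M) / real q ^ 4 \<le> C * (real q)\<^sup>2 / real q ^ 4"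
        using diff_le[of 0 "q\<^sup>2"] by (intro divide_right_mono) (auto simp: S0)
      also have "\<dots> = C * inverse (real q ^ 2)"
        using \<open>q \<ge> 1\<close> by (simp add: field_simps power2_eq_square power4_eq_xxxx)
      finally show "norm (\<integral>\<omega>. (S (q\<^sup>2) \<omega>)\<^sup>2 / real q ^ 4 \<partial>M) \<le> C * inverse (real q ^ 2)"
        by simp
    qed
  qed simp
  moreover have "AE \<omega> in M.
    (\<lambda>q. (\<Sum>m\<in>{q\<^sup>2..<(Suc q)\<^sup>2}. (S m \<omega> - S (q\<^sup>2) \<omega>)\<^sup>2) / real q ^ 4) \<longlonglongrightarrow> 0"
  proof (rule AE_tendsto_0_of_summable_expectation)
    show "integrable M (\<lambda>\<omega>. (\<Sum>m\<in>{q\<^sup>2..<(Suc q)\<^sup>2}. (S m \<omega> - S (q\<^sup>2) \<omega>)\<^sup>2) / real q ^ 4)" for q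
      by (intro Bochner_Integration.integrable_divide Bochner_Integration.integrable_sum diff_int)
        auto
    have "summable (\<lambda>q. 9 * C * inverse (real q ^ 2))"
      by (intro summable_mult inverse_power_summable) simp
    then show "summable (\<lambda>q. \<integral>\<omega>. (\<Sum>m\<in>{q\<^sup>2..<(Suc q)\<^sup>2}. (S m \<omega> - S (q\<^sup>2) \<omega>)\<^sup>2) / real q ^ 4 \<partial>M)"
    proof (rule summable_comparison_test')
      fix q :: nat assume q: "q \<ge> 1"
      have len: "(Suc q)\<^sup>2 - q\<^sup>2 = 2 * q + 1"
        by (simp add: power2_eq_square)
      have "(\<integral>\<omega>. (\<Sum>m\<in>{q\<^sup>2..<(Suc q)\<^sup>2}. (S m \<omega> - S (q\<^sup>2) \<omega>)\<^sup>2) \<partial>M)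
        = (\<Sum>m\<in>{q\<^sup>2..<(Suc q)\<^sup>2}. \<integral>\<omega>. (S m \<omega> - S (q\<^sup>2) \<omega>)\<^sup>2 \<partial>M)"
        by (intro Bochner_Integration.integral_sum diff_int) auto
      also have "\<dots> \<le> (\<Sum>m\<in>{q\<^sup>2..<(Suc q)\<^sup>2}. C * (3 * real q))"
      proof (intro sum_mono)
        fix m assume m: "m \<in> {q\<^sup>2..<(Suc q)\<^sup>2}"
        then have "m - q\<^sup>2 \<le> 3 * q" using len q by auto
        then have "real (m - q\<^sup>2) \<le> 3 * real q"
          by (metis of_nat_le_iff of_nat_mult of_nat_numeral)
        then have "C * real (m - q\<^sup>2) \<le> C * (3 * real q)"
          using C by (intro mult_left_mono)
        then show "(\<integral>\<omega>. (S m \<omega> - S (q\<^sup>2) \<omega>)\<^sup>2 \<partial>M) \<le> C * (3 * real q)"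
          using diff_le[of "q\<^sup>2" m] m by auto
      qed
      also have "\<dots> = real (2 * q + 1) * (C * (3 * real q))"
        by (simp only: sum_constant card_atLeastLessThan len)
      also have "\<dots> \<le> (3 * real q) * (C * (3 * real q))"
        using q C by (intro mult_right_mono) auto
      finally have "(\<integral>\<omega>. (\<Sum>m\<in>{q\<^sup>2..<(Suc q)\<^sup>2}. (S m \<omega> - S (q\<^sup>2) \<omega>)\<^sup>2) \<partial>M) / real q ^ 4
        \<le> (3 * real q) * (C * (3 * real q)) / real q ^ 4"
        by (intro divide_right_mono) auto
      also have "\<dots> = 9 * C * inverse (real q ^ 2)"
        using q by (simp add: field_simps power2_eq_square power4_eq_xxxx)
      finally show "norm (\<integral>\<omega>. (\<Sum>m\<in>{q\<^sup>2..<(Suc q)\<^sup>2}. (S m \<omega> - S (q\<^sup>2) \<omega>)\<^sup>2) / real q ^ 4 \<partial>M)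
          \<le> 9 * C * inverse (real q ^ 2)"
        by (simp add: integral_nonneg_AE sum_nonneg del: power_Suc)
    qed
  qed (simp add: sum_nonneg)
  ultimately show ?thesis
    unfolding S_def[symmetric]
    by eventually_elim (rule tendsto_0_along_squares)
qed

section \<open>Predictable multiples of independent innovations\<close>

text \<open>
  The sigma-algebra generated by \<open>V 1, \<dots>, V k\<close>. Realising it as a pullback along the vector of these
  variables makes every algebraic operation on functions of the past available through the
  ordinary closure rules for measurable functions.
\<close>
definition past :: "'a measure \<Rightarrow> (nat \<Rightarrow> 'a \<Rightarrow> real) \<Rightarrow> nat \<Rightarrow> 'a measure" where
  "past M V k = vimage_algebra (space M) (\<lambda>\<omega>. \<lambda>i\<in>{1..k}. V i \<omega>) (\<Pi>\<^sub>M i\<in>{1..k}. borel)"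

lemma space_past [simp]: "space (past M V k) = space M"
  by (simp add: past_def)

lemma measurable_past_history:
  "(\<lambda>\<omega>. \<lambda>i\<in>{1..k}. V i \<omega>) \<in> past M V k \<rightarrow>\<^sub>M (\<Pi>\<^sub>M i\<in>{1..k}. borel)"
  unfolding past_def by (rule measurable_vimage_algebra1) (auto simp: space_PiM)

lemma borel_measurable_past:
  assumes "1 \<le> i" "i \<le> k"
  shows "V i \<in> borel_measurable (past M V k)"
proof -
  have "(\<lambda>\<omega>. (\<lambda>i\<in>{1..k}. V i \<omega>) i) \<in> borel_measurable (past M V k)"
    by (rule measurable_compose[OF measurable_past_history measurable_component_singleton])
      (use assms in auto)
  then show ?thesis using assms by simp
qed

lemma borel_measurable_past_mono:
  assumes Y: "Y \<in> borel_measurable (past M V j)" and "j \<le> k"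
  shows "Y \<in> borel_measurable (past M V k)"
proof -
  have "(\<lambda>\<omega>. \<lambda>i\<in>{1..j}. V i \<omega>) \<in> past M V k \<rightarrow>\<^sub>M (\<Pi>\<^sub>M i\<in>{1..j}. borel)"
    using \<open>j \<le> k\<close> by (intro measurable_restrict borel_measurable_past) auto
  then have "(\<lambda>\<omega>. \<omega>) \<in> past M V k \<rightarrow>\<^sub>M past M V j"
    unfolding past_def[of M V j] by (intro measurable_vimage_algebra2) auto
  from measurable_compose[OF this Y] show ?thesis .
qed

lemma borel_measurable_of_past:
  assumes V: "\<And>i. 1 \<le> i \<Longrightarrow> V i \<in> borel_measurable M"
    and Y: "Y \<in> borel_measurable (past M V k)"
  shows "Y \<in> borel_measurable M"
proof -
  have "(\<lambda>\<omega>. \<lambda>i\<in>{1..k}. V i \<omega>) \<in> M \<rightarrow>\<^sub>M (\<Pi>\<^sub>M i\<in>{1..k}. borel)"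
    by (intro measurable_restrict V) auto
  then have "(\<lambda>\<omega>. \<omega>) \<in> M \<rightarrow>\<^sub>M past M V k"
    unfolding past_def by (intro measurable_vimage_algebra2) auto
  from measurable_compose[OF this Y] show ?thesis .
qed


context prob_space
begin

text \<open>
  The vector \<open>(V 1, \<dots>, V (k - 1))\<close> is independent of \<open>V k\<close>, and the events described by \<open>Y\<close> are among
  those described by the vector.
\<close>
lemma indep_var_past:
  assumes ind: "indep_vars (\<lambda>_. borel) V {1..}"
    and Y: "Y \<in> borel_measurable (past M V (k - 1))" and "1 \<le> k"
  shows "indep_var borel Y borel (V k)"
proof -
  define R where "R A \<omega> = (\<lambda>i\<in>A. V i \<omega>)" for A :: "nat set" and \<omega>
  define P where "P A = (\<Pi>\<^sub>M i\<in>A. (borel :: real measure))" for A :: "nat set"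
  have rv: "V i \<in> borel_measurable M" if "1 \<le> i" for i
    using ind that by (auto simp: indep_vars_def)
  have "indep_var (P {1..k - 1}) (R {1..k - 1}) (P {k}) (R {k})"
    unfolding P_def R_def using \<open>1 \<le> k\<close> by (intro indep_var_restrict[OF ind]) auto
  then have *: "indep_set (sets (vimage_algebra (space M) (R {1..k - 1}) (P {1..k - 1})))
      (sets (vimage_algebra (space M) (R {k}) (P {k})))"
    by (simp add: indep_var_eq sets_vimage_algebra)
  have sub: "sigma_sets (space M) {f -` B \<inter> space M |B. B \<in> sets borel}
      \<subseteq> sets (vimage_algebra (space M) (R A) (P A))"
    if "f \<in> borel_measurable (vimage_algebra (space M) (R A) (P A))" for f :: "'a \<Rightarrow> real" and A
    using sets_image_in_sets[OF _ that] by (simp add: sets_vimage_algebra)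
  have "(\<lambda>\<omega>. R {k} \<omega> k) \<in> borel_measurable (vimage_algebra (space M) (R {k}) (P {k}))"
    by (rule measurable_compose[OF measurable_vimage_algebra1])
      (auto simp: P_def R_def space_PiM PiE_def extensional_def)
  then have Vk: "V k \<in> borel_measurable (vimage_algebra (space M) (R {k}) (P {k}))"
    by (simp add: R_def)
  have "indep_set (sigma_sets (space M) {Y -` B \<inter> space M |B. B \<in> sets borel})
      (sigma_sets (space M) {V k -` B \<inter> space M |B. B \<in> sets borel})"
    using * sub[OF Vk] sub[OF Y[unfolded past_def P_def[symmetric] R_def[symmetric]]]
    unfolding indep_sets2_eq by (meson subset_iff)
  then show ?thesis
    unfolding indep_var_eq
    by (intro conjI borel_measurable_of_past[OF rv Y] rv \<open>1 \<le> k\<close>)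
qed

text \<open>
  The products \<open>Y (k - 1) * V k\<close> are orthogonal: for \<open>j < k\<close> the factor \<open>Y (j - 1) * V j * Y (k - 1)\<close>
  belongs to the past of time \<open>k - 1\<close>, hence is independent of the centred variable \<open>V k\<close>. Their second
  moments factor for the same reason and are therefore bounded.
\<close>
lemma AE_average_predictable_tendsto_0:
  fixes V Y :: "nat \<Rightarrow> 'a \<Rightarrow> real"
  assumes ind: "indep_vars (\<lambda>_. borel) V {1..}"
    and V_int: "\<And>k. 1 \<le> k \<Longrightarrow> integrable M (\<lambda>\<omega>. (V k \<omega>)\<^sup>2)"
    and V_le: "\<And>k. 1 \<le> k \<Longrightarrow> expectation (\<lambda>\<omega>. (V k \<omega>)\<^sup>2) \<le> v"
    and V_mean: "\<And>k. 1 \<le> k \<Longrightarrow> expectation (V k) = 0"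
    and Y: "\<And>k. Y k \<in> borel_measurable (past M V k)"
    and Y_int: "\<And>k. integrable M (\<lambda>\<omega>. (Y k \<omega>)\<^sup>2)"
    and Y_le: "\<And>k. expectation (\<lambda>\<omega>. (Y k \<omega>)\<^sup>2) \<le> C"
  shows "AE \<omega> in M. (\<lambda>n. (\<Sum>k=1..n. Y (k - 1) \<omega> * V k \<omega>) / real n) \<longlonglongrightarrow> 0"
proof (rule AE_average_orthogonal_tendsto_0)
  have V_meas: "V k \<in> borel_measurable M" if "1 \<le> k" for k
    using ind that by (auto simp: indep_vars_def)
  have Y_meas: "Y k \<in> borel_measurable M" for k
    by (rule borel_measurable_of_past[OF V_meas Y])
  have C: "0 \<le> C"
    by (rule order_trans[OF Bochner_Integration.integral_nonneg Y_le[of 0]]) simp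
  have V1: "integrable M (V k)" if "1 \<le> k" for k
    using square_integrable_imp_integrable[OF V_meas V_int] that by simp
  fix k :: nat assume k: "1 \<le> k"
  show D_meas: "(\<lambda>\<omega>. Y (k - 1) \<omega> * V k \<omega>) \<in> borel_measurable M"
    by (intro borel_measurable_times Y_meas V_meas k)
  have "indep_var borel ((\<lambda>x. x\<^sup>2) \<circ> Y (k - 1)) borel ((\<lambda>x. x\<^sup>2) \<circ> V k)"
    by (rule indep_var_compose[OF indep_var_past[OF ind Y k]]) auto
  then have sq: "indep_var borel (\<lambda>\<omega>. (Y (k - 1) \<omega>)\<^sup>2) borel (\<lambda>\<omega>. (V k \<omega>)\<^sup>2)"
    by (simp add: comp_def)
  show "integrable M (\<lambda>\<omega>. (Y (k - 1) \<omega> * V k \<omega>)\<^sup>2)"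
    unfolding power_mult_distrib by (rule indep_var_integrable[OF sq Y_int V_int[OF k]])
  have "expectation (\<lambda>\<omega>. (Y (k - 1) \<omega> * V k \<omega>)\<^sup>2)
      = expectation (\<lambda>\<omega>. (Y (k - 1) \<omega>)\<^sup>2) * expectation (\<lambda>\<omega>. (V k \<omega>)\<^sup>2)"
    unfolding power_mult_distrib by (rule indep_var_lebesgue_integral[OF sq Y_int V_int[OF k]])
  also have "\<dots> \<le> C * v"
    by (intro mult_mono Y_le V_le k C) simp
  finally show "expectation (\<lambda>\<omega>. (Y (k - 1) \<omega> * V k \<omega>)\<^sup>2) \<le> C * v" .
next
  have V_meas: "V k \<in> borel_measurable M" if "1 \<le> k" for k
    using ind that by (auto simp: indep_vars_def)
  have Y_meas: "Y k \<in> borel_measurable M" for k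
    by (rule borel_measurable_of_past[OF V_meas Y])
  fix j k :: nat assume jk: "1 \<le> j" "j < k"
  \<comment> \<open>all factors except the last innovation belong to the past of time \<open>k - 1\<close>\<close>
  have Z_past: "(\<lambda>\<omega>. (Y (j - 1) \<omega> * V j \<omega>) * Y (k - 1) \<omega>) \<in> borel_measurable (past M V (k - 1))"
    using jk by (intro borel_measurable_times borel_measurable_past
        borel_measurable_past_mono[OF Y]) auto
  have "indep_var borel ((\<lambda>x. x\<^sup>2) \<circ> Y (j - 1)) borel ((\<lambda>x. x\<^sup>2) \<circ> V j)"
    by (rule indep_var_compose[OF indep_var_past[OF ind Y]]) (use jk in simp_all)
  then have "integrable M (\<lambda>\<omega>. (Y (j - 1) \<omega> * V j \<omega>)\<^sup>2)"
    unfolding power_mult_distrib comp_def using jk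
    by (intro indep_var_integrable[OF _ Y_int V_int]) auto
  then have Z_int: "integrable M (\<lambda>\<omega>. (Y (j - 1) \<omega> * V j \<omega>) * Y (k - 1) \<omega>)"
    using jk by (intro integrable_mult_of_square_integrable Y_int borel_measurable_times Y_meas V_meas)
  have "expectation (\<lambda>\<omega>. ((Y (j - 1) \<omega> * V j \<omega>) * Y (k - 1) \<omega>) * V k \<omega>)
      = expectation (\<lambda>\<omega>. (Y (j - 1) \<omega> * V j \<omega>) * Y (k - 1) \<omega>) * expectation (V k)"
    using jk square_integrable_imp_integrable[OF V_meas V_int]
    by (intro indep_var_lebesgue_integral indep_var_past[OF ind Z_past] Z_int) auto
  then show "expectation (\<lambda>\<omega>. (Y (j - 1) \<omega> * V j \<omega>) * (Y (k - 1) \<omega> * V k \<omega>)) = 0"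
    using jk V_mean[of k] by (simp add: mult.assoc)
qed

end

section \<open>Stable first-order recursions\<close>

primrec ar1 :: "real \<Rightarrow> real \<Rightarrow> (nat \<Rightarrow> real) \<Rightarrow> nat \<Rightarrow> real" where
  "ar1 a z v 0 = z"
| "ar1 a z v (Suc n) = a * ar1 a z v n + v (Suc n)"

lemma ar1_unique:
  assumes "\<And>n. 1 \<le> n \<Longrightarrow> x n = a * x (n - 1) + v n"
  shows "x n = ar1 a (x 0) v n"
  by (induction n) (use assms in auto)

text \<open>
  Linearity separates the response to the starting value from the response to each part of the
  driving term.
\<close>
lemma ar1_superposition:
  "ar1 a z (\<lambda>n. v n + c * w n) n = ar1 a 0 v n + c * ar1 a 0 w n + z * a ^ n"
  by (induction n) (auto simp: algebra_simps)

text \<open>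
  Convexity of the square, applied to the weights \<open>\<bar>a\<bar>\<close> and \<open>1 - \<bar>a\<bar>\<close> and the points \<open>sgn a * x\<close> and
  \<open>v / (1 - \<bar>a\<bar>)\<close>. The factor \<open>\<bar>a\<bar> < 1\<close> in front of \<open>x\<^sup>2\<close> makes a stable recursion a contraction for squares
  too, whatever the dependence between \<open>x\<close> and \<open>v\<close>.
\<close>
lemma square_convex_bound:
  fixes a x v :: real
  assumes "\<bar>a\<bar> < 1"
  shows "(a * x + v)\<^sup>2 \<le> \<bar>a\<bar> * x\<^sup>2 + v\<^sup>2 / (1 - \<bar>a\<bar>)"
proof -
  define r where "r = 1 - \<bar>a\<bar>"
  have r: "0 < r" "\<bar>a\<bar> = 1 - r" using assms by (auto simp: r_def)
  \<comment> \<open>the defect in the inequality is exactly this square\<close>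
  have "0 \<le> \<bar>a\<bar> / r * (r * x - sgn a * v)\<^sup>2"
    using r(1) by (intro mult_nonneg_nonneg divide_nonneg_pos) simp_all
  also have "\<dots> = \<bar>a\<bar> * r * x\<^sup>2 - 2 * a * x * v + \<bar>a\<bar> * (sgn a)\<^sup>2 * v\<^sup>2 / r"
    using r(1) by (simp add: power2_eq_square field_simps abs_sgn[of a] sgn_if)
  also have "\<bar>a\<bar> * (sgn a)\<^sup>2 = \<bar>a\<bar>"
    by (simp add: sgn_if power2_eq_square)
  also have "\<bar>a\<bar> * r * x\<^sup>2 = \<bar>a\<bar> * x\<^sup>2 - a\<^sup>2 * x\<^sup>2"
    by (simp add: r_def algebra_simps power2_eq_square)
  also have "\<bar>a\<bar> * v\<^sup>2 / r = v\<^sup>2 / r - v\<^sup>2"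
    using r by (simp add: diff_divide_distrib left_diff_distrib)
  finally show ?thesis
    unfolding r_def[symmetric] by (simp add: power2_eq_square algebra_simps)
qed

lemma ar1_bounded:
  assumes a: "\<bar>a\<bar> < 1" and v: "\<And>n. \<bar>v n\<bar> \<le> C"
  shows "\<bar>ar1 a 0 v n\<bar> \<le> C / (1 - \<bar>a\<bar>)"
proof (induction n)
  case 0
  then show ?case using a order_trans[OF abs_ge_zero v] by simp
next
  case (Suc n)
  have "\<bar>ar1 a 0 v (Suc n)\<bar> \<le> \<bar>a\<bar> * \<bar>ar1 a 0 v n\<bar> + \<bar>v (Suc n)\<bar>"
    by (simp add: abs_mult[symmetric] abs_triangle_ineq)
  also have "\<dots> \<le> \<bar>a\<bar> * (C / (1 - \<bar>a\<bar>)) + C"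
    by (intro add_mono mult_left_mono Suc v) auto
  also have "\<dots> = C / (1 - \<bar>a\<bar>)"
    using a by (simp add: field_simps)
  finally show ?case .
qed

text \<open>
  \<open>C / (1 - \<bar>a\<bar>)\<^sup>2\<close> is the fixed point of the recursion \<open>s \<mapsto> \<bar>a\<bar> s + C / (1 - \<bar>a\<bar>)\<close> that
  \<open>square_convex_bound\<close> gives for the second moments.
\<close>
lemma ar1_second_moment:
  fixes v :: "nat \<Rightarrow> 'a \<Rightarrow> real"
  assumes a: "\<bar>a\<bar> < 1"
    and meas: "\<And>n. 1 \<le> n \<Longrightarrow> v n \<in> borel_measurable M"
    and int: "\<And>n. 1 \<le> n \<Longrightarrow> integrable M (\<lambda>\<omega>. (v n \<omega>)\<^sup>2)"
    and le: "\<And>n. 1 \<le> n \<Longrightarrow> (\<integral>\<omega>. (v n \<omega>)\<^sup>2 \<partial>M) \<le> C"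
  shows "(\<lambda>\<omega>. ar1 a 0 (\<lambda>k. v k \<omega>) n) \<in> borel_measurable M \<and>
    integrable M (\<lambda>\<omega>. (ar1 a 0 (\<lambda>k. v k \<omega>) n)\<^sup>2) \<and>
    (\<integral>\<omega>. (ar1 a 0 (\<lambda>k. v k \<omega>) n)\<^sup>2 \<partial>M) \<le> C / (1 - \<bar>a\<bar>)\<^sup>2"
proof (induction n)
  case 0
  have "0 \<le> C"
    by (rule order_trans[OF Bochner_Integration.integral_nonneg le[of 1]]) simp_all
  then show ?case by simp
next
  case (Suc n)
  let ?x = "\<lambda>\<omega>. ar1 a 0 (\<lambda>k. v k \<omega>) n"
  let ?b = "\<lambda>\<omega>. \<bar>a\<bar> * (?x \<omega>)\<^sup>2 + (v (Suc n) \<omega>)\<^sup>2 / (1 - \<bar>a\<bar>)"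
  have [measurable]: "?x \<in> borel_measurable M" "v (Suc n) \<in> borel_measurable M"
    using Suc meas by auto
  have b_int: "integrable M ?b"
    using Suc int[of "Suc n"] by simp
  have s_int: "integrable M (\<lambda>\<omega>. (a * ?x \<omega> + v (Suc n) \<omega>)\<^sup>2)"
    by (rule Bochner_Integration.integrable_bound[OF b_int])
      (use square_convex_bound[OF a] in \<open>auto intro!: AE_I2 order_trans[OF _ abs_ge_self]\<close>)
  have "(\<integral>\<omega>. (a * ?x \<omega> + v (Suc n) \<omega>)\<^sup>2 \<partial>M) \<le> integral\<^sup>L M ?b"
    by (intro integral_mono s_int b_int square_convex_bound a)
  also have "\<dots> = \<bar>a\<bar> * (\<integral>\<omega>. (?x \<omega>)\<^sup>2 \<partial>M) + (\<integral>\<omega>. (v (Suc n) \<omega>)\<^sup>2 \<partial>M) / (1 - \<bar>a\<bar>)"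
    using Suc int[of "Suc n"] by simp
  also have "\<dots> \<le> \<bar>a\<bar> * (C / (1 - \<bar>a\<bar>)\<^sup>2) + C / (1 - \<bar>a\<bar>)"
    using Suc le[of "Suc n"] a by (intro add_mono mult_left_mono divide_right_mono) auto
  also have "\<dots> = C / (1 - \<bar>a\<bar>)\<^sup>2"
  proof -
    define r where "r = 1 - \<bar>a\<bar>"
    have "0 < r" "\<bar>a\<bar> = 1 - r" using a by (auto simp: r_def)
    then show ?thesis
      by (simp only: \<open>\<bar>a\<bar> = 1 - r\<close>) (simp add: field_simps power2_eq_square)
  qed
  finally show ?case using s_int by simp
qed

text \<open>
  Once \<open>d n\<close> stays below \<open>(1 - r) \<epsilon> / 2\<close>, the excess of \<open>w\<close> over the fixed point \<open>\<epsilon> / 2\<close> shrinks by the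
  factor \<open>r\<close> at every step. The recursion is asked for from \<open>n = 1\<close> on only, since the
  normalised squares \<open>(x n)\<^sup>2 / real n\<close> to which it is applied take the value \<open>0\<close> at \<open>n = 0\<close> by convention.
\<close>
lemma tendsto_0_of_contraction:
  fixes w d :: "nat \<Rightarrow> real"
  assumes r: "0 \<le> r" "r < 1" and w: "\<And>n. 0 \<le> w n"
    and step: "\<And>n. 1 \<le> n \<Longrightarrow> w (Suc n) \<le> r * w n + d n"
    and d: "d \<longlonglongrightarrow> 0"
  shows "w \<longlonglongrightarrow> 0"
proof (rule LIMSEQ_I)
  fix \<epsilon> :: real assume \<epsilon>: "0 < \<epsilon>"
  then have "0 < (1 - r) * (\<epsilon> / 2)" using r by simp
  with d have "\<forall>\<^sub>F n in sequentially. d n < (1 - r) * (\<epsilon> / 2)"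
    by (rule order_tendstoD(2))
  then obtain N0 where N0: "\<And>n. n \<ge> N0 \<Longrightarrow> d n < (1 - r) * (\<epsilon> / 2)"
    unfolding eventually_sequentially by blast
  define N where "N = max 1 N0"
  have decay: "w (N + k) \<le> r ^ k * w N + \<epsilon> / 2" for k
  proof (induction k)
    case 0 then show ?case using \<epsilon> by simp
  next
    case (Suc k)
    have "w (N + Suc k) \<le> r * w (N + k) + d (N + k)"
      using step[of "N + k"] by (simp add: N_def)
    also have "\<dots> \<le> r * (r ^ k * w N + \<epsilon> / 2) + (1 - r) * (\<epsilon> / 2)"
      using r Suc by (intro add_mono mult_left_mono less_imp_le[OF N0]) (auto simp: N_def)
    also have "\<dots> = r ^ Suc k * w N + \<epsilon> / 2" by (simp add: field_simps)
    finally show ?case .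
  qed
  have "(\<lambda>k. r ^ k * w N) \<longlonglongrightarrow> 0"
    using LIMSEQ_realpow_zero[OF r] by (rule tendsto_mult_left_zero)
  then have "\<forall>\<^sub>F k in sequentially. r ^ k * w N < \<epsilon> / 2"
    using \<epsilon> by (intro order_tendstoD(2)) auto
  then obtain K where K: "\<And>k. k \<ge> K \<Longrightarrow> r ^ k * w N < \<epsilon> / 2"
    unfolding eventually_sequentially by blast
  have "norm (w n - 0) < \<epsilon>" if "n \<ge> N + K" for n
  proof -
    have "N + (n - N) = n" "K \<le> n - N" using that by auto
    then show ?thesis
      using decay[of "n - N"] K[of "n - N"] w[of n] by simp
  qed
  then show "\<exists>N. \<forall>n\<ge>N. norm (w n - 0) < \<epsilon>" by blast
qed

lemma ar1_square_div_index_tendsto_0: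
  fixes x v :: "nat \<Rightarrow> real"
  assumes a: "\<bar>a\<bar> < 1"
    and x: "\<And>n. 1 \<le> n \<Longrightarrow> x n = a * x (n - 1) + v n"
    and v: "(\<lambda>n. (v n)\<^sup>2 / real n) \<longlonglongrightarrow> 0"
  shows "(\<lambda>n. (x n)\<^sup>2 / real n) \<longlonglongrightarrow> 0"
proof (rule tendsto_0_of_contraction[of "\<bar>a\<bar>"])
  show "(x (Suc n))\<^sup>2 / real (Suc n) \<le> \<bar>a\<bar> * ((x n)\<^sup>2 / real n)
      + ((v (Suc n))\<^sup>2 / real (Suc n)) / (1 - \<bar>a\<bar>)" if "1 \<le> n" for n
  proof -
    have "(x (Suc n))\<^sup>2 / real (Suc n)
        \<le> (\<bar>a\<bar> * (x n)\<^sup>2 + (v (Suc n))\<^sup>2 / (1 - \<bar>a\<bar>)) / real (Suc n)"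
      using x[of "Suc n"] square_convex_bound[OF a] by (intro divide_right_mono) auto
    also have "\<dots> = \<bar>a\<bar> * (x n)\<^sup>2 / real (Suc n) + ((v (Suc n))\<^sup>2 / real (Suc n)) / (1 - \<bar>a\<bar>)"
      by (simp add: add_divide_distrib mult.commute)
    also have "\<bar>a\<bar> * (x n)\<^sup>2 / real (Suc n) \<le> \<bar>a\<bar> * (x n)\<^sup>2 / real n"
      using that by (intro divide_left_mono) auto
    finally show ?thesis by simp
  qed
  show "(\<lambda>n. ((v (Suc n))\<^sup>2 / real (Suc n)) / (1 - \<bar>a\<bar>)) \<longlonglongrightarrow> 0"
    using LIMSEQ_Suc[OF v] by (rule tendsto_divide_zero)
qed (use a in auto)

section \<open>The estimator along a trajectory\<close>

text \<open>
  Multiply \<open>x k = (\<theta> + \<rho>) * x (k - 1) - \<theta> * \<rho> * x (k - 2) + v k\<close> by \<open>x (k - 1)\<close> and sum: the lag-two term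
  reproduces the sum on the left up to its last summand. Writing the boundary terms with \<open>e\<close> instead
  of \<open>x (n - 1)\<close> makes the identity valid for all \<open>n\<close>, including \<open>n = 0\<close>.
\<close>
lemma ls_normal_equation:
  fixes x e v :: "nat \<Rightarrow> real"
  assumes x: "\<And>n. 1 \<le> n \<Longrightarrow> x n = \<theta> * x (n - 1) + e n"
    and e: "\<And>n. 1 \<le> n \<Longrightarrow> e n = \<rho> * e (n - 1) + v n"
  shows "(1 + \<theta> * \<rho>) * (\<Sum>k=1..n. x k * x (k - 1))
    = (\<theta> + \<rho>) * (\<Sum>k=1..n. (x (k - 1))\<^sup>2) + (\<Sum>k=1..n. x (k - 1) * v k)
      + \<rho> * (x 0 * (e 0 - x 0) - x n * (e n - x n))"
proof (induction n)
  case (Suc n)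
  have e_eq: "e (Suc n) = x (Suc n) - \<theta> * x n" and v_eq: "v (Suc n) = e (Suc n) - \<rho> * e n"
    using x[of "Suc n"] e[of "Suc n"] by auto
  show ?case
    using Suc by (simp add: v_eq) (simp add: e_eq algebra_simps power2_eq_square)
qed simp

text \<open>
  The innovation \<open>v k\<close> is recovered from \<open>x\<close> by two first-order differences, and each difference
  increases the sum of squares by a factor of at most \<open>4\<close>, apart from boundary terms.
\<close>
lemma innovations_energy_le:
  fixes x e v :: "nat \<Rightarrow> real"
  assumes \<theta>: "\<bar>\<theta>\<bar> < 1" and \<rho>: "\<bar>\<rho>\<bar> < 1"
    and x: "\<And>n. 1 \<le> n \<Longrightarrow> x n = \<theta> * x (n - 1) + e n"
    and e: "\<And>n. 1 \<le> n \<Longrightarrow> e n = \<rho> * e (n - 1) + v n"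
  shows "(\<Sum>k=1..n. (v k)\<^sup>2) \<le> 16 * (\<Sum>k=1..n. (x (k - 1))\<^sup>2) + 8 * (x n)\<^sup>2 + 2 * (e 0)\<^sup>2"
proof -
  have sq: "(p - a * q)\<^sup>2 \<le> 2 * p\<^sup>2 + 2 * q\<^sup>2" if "\<bar>a\<bar> < 1" for a p q :: real
  proof -
    have "(p - a * q)\<^sup>2 \<le> 2 * p\<^sup>2 + 2 * (a * q)\<^sup>2"
      using zero_le_power2[of "p + a * q"] by (simp add: power2_eq_square algebra_simps)
    moreover have "(a * q)\<^sup>2 \<le> q\<^sup>2"
      using that by (simp add: power_mult_distrib mult_left_le_one_le abs_square_le_1)
    ultimately show ?thesis by linarith
  qed
  have shift: "(\<Sum>k=1..n. f k) = (\<Sum>k=1..n. f (k - 1)) + f n - f 0" for f :: "nat \<Rightarrow> real" and n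
    by (induction n) auto
  have bound: "(\<Sum>k=1..n. (z k)\<^sup>2) \<le> 4 * (\<Sum>k=1..n. (y (k - 1))\<^sup>2) + 2 * (y n)\<^sup>2"
    if "\<bar>a\<bar> < 1" "\<And>k. 1 \<le> k \<Longrightarrow> y k = a * y (k - 1) + z k" for a and y z :: "nat \<Rightarrow> real"
  proof -
    have "(\<Sum>k=1..n. (z k)\<^sup>2) \<le> (\<Sum>k=1..n. 2 * (y k)\<^sup>2 + 2 * (y (k - 1))\<^sup>2)"
    proof (rule sum_mono)
      fix k assume "k \<in> {1..n}"
      then have "z k = y k - a * y (k - 1)" using that(2)[of k] by simp
      then show "(z k)\<^sup>2 \<le> 2 * (y k)\<^sup>2 + 2 * (y (k - 1))\<^sup>2" using sq[OF that(1)] by simp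
    qed
    also have "\<dots> = 2 * (\<Sum>k=1..n. (y k)\<^sup>2) + 2 * (\<Sum>k=1..n. (y (k - 1))\<^sup>2)"
      by (simp add: sum.distrib sum_distrib_left)
    finally show ?thesis
      using shift[of "\<lambda>k. (y k)\<^sup>2" n] zero_le_power2[of "y 0"] by linarith
  qed
  have "(\<Sum>k=1..n. (v k)\<^sup>2) \<le> (\<Sum>k=1..n. 2 * (e k)\<^sup>2 + 2 * (e (k - 1))\<^sup>2)"
  proof (rule sum_mono)
    fix k assume "k \<in> {1..n}"
    then have "v k = e k - \<rho> * e (k - 1)" using e[of k] by simp
    then show "(v k)\<^sup>2 \<le> 2 * (e k)\<^sup>2 + 2 * (e (k - 1))\<^sup>2" using sq[OF \<rho>] by simp
  qed
  also have "\<dots> = 2 * (\<Sum>k=1..n. (e k)\<^sup>2) + 2 * (\<Sum>k=1..n. (e (k - 1))\<^sup>2)"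
    by (simp add: sum.distrib sum_distrib_left)
  finally show ?thesis
    using shift[of "\<lambda>k. (e k)\<^sup>2" n] bound[of \<theta> x e, OF \<theta> x] zero_le_power2[of "e n"] by linarith
qed

text \<open>
  The deterministic core. The normal equation gives \<open>N/D = (\<theta> + \<rho>)/(1 + \<theta>\<rho>) + (R/D)/(1 + \<theta>\<rho>)\<close>; the
  remainder \<open>R\<close> is \<open>o(n)\<close> and the energy bound makes \<open>D\<close> eventually at least \<open>m n / 32\<close>.
\<close>
lemma ls_estimator_tendsto:
  fixes x e v :: "nat \<Rightarrow> real"
  assumes \<theta>: "\<bar>\<theta>\<bar> < 1" and \<rho>: "\<bar>\<rho>\<bar> < 1"
    and x: "\<And>n. 1 \<le> n \<Longrightarrow> x n = \<theta> * x (n - 1) + e n"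
    and e: "\<And>n. 1 \<le> n \<Longrightarrow> e n = \<rho> * e (n - 1) + v n"
    and v: "(\<lambda>n. (v n)\<^sup>2 / real n) \<longlonglongrightarrow> 0"
    and cross: "(\<lambda>n. (\<Sum>k=1..n. x (k - 1) * v k) / real n) \<longlonglongrightarrow> 0"
    and energy: "(\<lambda>n. (\<Sum>k=1..n. min ((v k)\<^sup>2) 1) / real n) \<longlonglongrightarrow> m" and m: "0 < m"
  shows "ls_estimator x \<longlonglongrightarrow> (\<theta> + \<rho>) / (1 + \<theta> * \<rho>)"
proof -
  define D where "D n = (\<Sum>k=1..n. (x (k - 1))\<^sup>2)" for n
  define R where "R n = (\<Sum>k=1..n. x (k - 1) * v k) + \<rho> * (x 0 * (e 0 - x 0) - x n * (e n - x n))" for n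
  have "\<bar>\<theta> * \<rho>\<bar> < 1"
    using \<theta> \<rho> mult_strict_mono'[of "\<bar>\<theta>\<bar>" 1 "\<bar>\<rho>\<bar>" 1] by (simp add: abs_mult)
  then have pos: "0 < 1 + \<theta> * \<rho>" by linarith
  have e0: "(\<lambda>n. (e n)\<^sup>2 / real n) \<longlonglongrightarrow> 0"
    by (rule ar1_square_div_index_tendsto_0[OF \<rho> e v])
  have x0: "(\<lambda>n. (x n)\<^sup>2 / real n) \<longlonglongrightarrow> 0"
    by (rule ar1_square_div_index_tendsto_0[OF \<theta> x e0])
  have const: "(\<lambda>n. c / real n) \<longlonglongrightarrow> 0" for c :: real
    by (rule lim_const_over_n)
  have xe: "(\<lambda>n. x n * e n / real n) \<longlonglongrightarrow> 0"
  proof (rule Lim_null_comparison)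
    show "(\<lambda>n. (x n)\<^sup>2 / real n + (e n)\<^sup>2 / real n) \<longlonglongrightarrow> 0"
      using tendsto_add[OF x0 e0] by simp
    show "\<forall>\<^sub>F n in sequentially. norm (x n * e n / real n) \<le> (x n)\<^sup>2 / real n + (e n)\<^sup>2 / real n"
    proof (intro always_eventually allI)
      fix n
      have "0 \<le> (\<bar>x n\<bar> - \<bar>e n\<bar>)\<^sup>2" "0 \<le> \<bar>x n\<bar> * \<bar>e n\<bar>" by simp_all
      then have "\<bar>x n * e n\<bar> \<le> (x n)\<^sup>2 + (e n)\<^sup>2"
        unfolding power2_diff power2_abs abs_mult by linarith
      then show "norm (x n * e n / real n) \<le> (x n)\<^sup>2 / real n + (e n)\<^sup>2 / real n"
        by (simp add: add_divide_distrib[symmetric] divide_right_mono)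
    qed
  qed
  have "(\<lambda>n. (\<Sum>k=1..n. x (k - 1) * v k) / real n
      + \<rho> * (x 0 * (e 0 - x 0) / real n - (x n * e n / real n - (x n)\<^sup>2 / real n))) \<longlonglongrightarrow> 0 + \<rho> * (0 - (0 - 0))"
    by (intro tendsto_intros cross xe x0 const)
  then have R: "(\<lambda>n. R n / real n) \<longlonglongrightarrow> 0"
    unfolding R_def by (simp add: add_divide_distrib diff_divide_distrib right_diff_distrib power2_eq_square)

  \<comment> \<open>a lower bound for \<open>D n / n\<close>, obtained by solving the energy inequality for \<open>D n\<close>\<close>
  define L where "L n = ((\<Sum>k=1..n. min ((v k)\<^sup>2) 1) / real n
    - 8 * ((x n)\<^sup>2 / real n) - 2 * (e 0)\<^sup>2 / real n) / 16" for n
  have "L \<longlonglongrightarrow> (m - 8 * 0 - 0) / 16"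
    unfolding L_def by (intro tendsto_intros energy x0 const) simp
  then have L_pos: "\<forall>\<^sub>F n in sequentially. m / 32 < L n"
    using m by (intro order_tendstoD(1)) auto
  have L_le: "L n \<le> D n / real n" for n
  proof -
    have "(\<Sum>k=1..n. min ((v k)\<^sup>2) 1) \<le> (\<Sum>k=1..n. (v k)\<^sup>2)"
      by (intro sum_mono) simp
    then have "((\<Sum>k=1..n. min ((v k)\<^sup>2) 1) - 8 * (x n)\<^sup>2 - 2 * (e 0)\<^sup>2) / 16 \<le> D n"
      using innovations_energy_le[of \<theta> \<rho> x e v n, OF \<theta> \<rho> x e] by (simp add: D_def)
    from divide_right_mono[OF this, of "real n"] show ?thesis
      by (simp add: L_def diff_divide_distrib)
  qed
  have lower: "\<forall>\<^sub>F n in sequentially. m / 32 < D n / real n"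
    using L_pos by (rule eventually_mono) (rule less_le_trans[OF _ L_le])

  have "(\<lambda>n. R n / D n) \<longlonglongrightarrow> 0"
  proof (rule Lim_null_comparison)
    show "(\<lambda>n. 32 / m * \<bar>R n / real n\<bar>) \<longlonglongrightarrow> 0"
      using tendsto_mult[OF tendsto_const tendsto_rabs[OF R], of "32 / m"] by simp
    show "\<forall>\<^sub>F n in sequentially. norm (R n / D n) \<le> 32 / m * \<bar>R n / real n\<bar>"
      using lower eventually_gt_at_top[of 0]
    proof eventually_elim
      case (elim n)
      then have D_gt: "m / 32 * real n < D n" by (simp add: pos_less_divide_eq)
      have "0 < m / 32 * real n" using elim m by simp
      moreover from this D_gt have "0 < D n" by (rule less_trans)
      moreover from calculation D_gt elim(2) m have "\<bar>R n\<bar> / D n \<le> \<bar>R n\<bar> / (m / 32 * real n)"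
        by (intro divide_left_mono mult_pos_pos) auto
      ultimately show ?case by (simp add: abs_divide field_simps)
    qed
  qed
  then have "(\<lambda>n. (\<theta> + \<rho>) / (1 + \<theta> * \<rho>) + R n / D n / (1 + \<theta> * \<rho>)) \<longlonglongrightarrow> (\<theta> + \<rho>) / (1 + \<theta> * \<rho>)"
    using tendsto_add[OF tendsto_const tendsto_divide_zero] by force
  then show ?thesis
  proof (rule Lim_transform_eventually)
    show "\<forall>\<^sub>F n in sequentially. (\<theta> + \<rho>) / (1 + \<theta> * \<rho>) + R n / D n / (1 + \<theta> * \<rho>) = ls_estimator x n"
      using lower
    proof eventually_elim
      case (elim n)
      then have "D n \<noteq> 0" using m by auto
      \<comment> \<open>stated for opaque quantities, which keeps the sums out of the field arithmetic\<close>
      have solve: "a / p + r / d / p = N / d" if "p \<noteq> 0" "d \<noteq> 0" "p * N = a * d + r"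
        for a d N p r :: real
      proof -
        have "N = (a * d + r) / p" using that by (simp add: eq_divide_eq mult.commute)
        show ?thesis
          unfolding \<open>N = (a * d + r) / p\<close> using that(1,2) by (simp add: field_simps)
      qed
      show ?case
        unfolding ls_estimator_def D_def[symmetric]
      proof (rule solve)
        show "(1 + \<theta> * \<rho>) * (\<Sum>k=1..n. x k * x (k - 1)) = (\<theta> + \<rho>) * D n + R n"
          using ls_normal_equation[of x \<theta> e \<rho> v n, OF x e] by (simp add: D_def R_def)
      qed (use pos \<open>D n \<noteq> 0\<close> in auto)
    qed
  qed
qed

section \<open>Almost sure behaviour of the innovations\<close>

context prob_space
begin

text \<open>
  A nonnegative variable \<open>Z\<close> satisfies \<open>\<Sum>n\<ge>1. P(Z > \<delta> n) \<le> E Z / \<delta>\<close>, because the number of integers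
  \<open>n \<ge> 1\<close> with \<open>\<delta> n < Z\<close> is at most \<open>Z / \<delta>\<close>. Identical distribution transfers this to the events
  \<open>Z n > \<delta> n\<close>, and the first Borel-Cantelli lemma applies for each \<open>\<delta> = 1 / (i + 1)\<close>.
\<close>
lemma AE_div_index_tendsto_0:
  fixes Z :: "nat \<Rightarrow> 'a \<Rightarrow> real"
  assumes meas: "\<And>n. 1 \<le> n \<Longrightarrow> Z n \<in> borel_measurable M"
    and nonneg: "\<And>n \<omega>. 0 \<le> Z n \<omega>"
    and distr: "\<And>n. 1 \<le> n \<Longrightarrow> distr M borel (Z n) = distr M borel (Z 1)"
    and int: "integrable M (Z 1)"
  shows "AE \<omega> in M. (\<lambda>n. Z n \<omega> / real n) \<longlonglongrightarrow> 0"
proof -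
  have step: "AE \<omega> in M. \<forall>\<^sub>F n in sequentially. Z (Suc n) \<omega> \<le> \<delta> * real (Suc n)" if "\<delta> > 0" for \<delta>
  proof -
    define A where "A n = {\<omega>\<in>space M. \<delta> * real (Suc n) < Z (Suc n) \<omega>}" for n
    \<comment> \<open>the same thresholds for one fixed variable, so that the events can be counted pointwise\<close>
    define B where "B n = {\<omega>\<in>space M. \<delta> * real (Suc n) < Z 1 \<omega>}" for n
    have [measurable]: "Z (Suc n) \<in> borel_measurable M" "Z 1 \<in> borel_measurable M" for n
      using meas by auto
    have A: "A n \<in> sets M" and B: "B n \<in> sets M" for n
      unfolding A_def B_def by measurable
    have AB: "prob (A n) = prob (B n)" for n
    proof -
      have "prob (A n) = measure (distr M borel (Z (Suc n))) {\<delta> * real (Suc n)<..}"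
        by (subst measure_distr) (auto simp: A_def intro!: arg_cong[where f=prob])
      also have "\<dots> = measure (distr M borel (Z 1)) {\<delta> * real (Suc n)<..}"
        using distr[of "Suc n"] by simp
      also have "\<dots> = prob (B n)"
        by (subst measure_distr) (auto simp: B_def intro!: arg_cong[where f=prob])
      finally show ?thesis .
    qed
    have count: "(\<Sum>n<N. indicator (B n) \<omega>) \<le> Z 1 \<omega> / \<delta>" if "\<omega> \<in> space M" for N \<omega>
    proof -
      have "(\<Sum>n<N. indicator (B n) \<omega>) = real (card {n\<in>{..<N}. \<omega> \<in> B n})"
        by (simp add: indicator_def sum.If_cases Int_def)
      also have "\<dots> \<le> real (card {..<nat \<lfloor>Z 1 \<omega> / \<delta>\<rfloor>})"
      proof (intro of_nat_mono card_mono subsetI)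
        fix n assume "n \<in> {n\<in>{..<N}. \<omega> \<in> B n}"
        then have "real (Suc n) \<le> Z 1 \<omega> / \<delta>"
          using \<open>\<delta> > 0\<close> by (simp add: B_def field_simps)
        then have "int (Suc n) \<le> \<lfloor>Z 1 \<omega> / \<delta>\<rfloor>"
          by (simp add: le_floor_iff)
        then show "n \<in> {..<nat \<lfloor>Z 1 \<omega> / \<delta>\<rfloor>}" by simp
      qed simp
      also have "\<dots> \<le> Z 1 \<omega> / \<delta>"
        using nonneg[of 1 \<omega>] \<open>\<delta> > 0\<close> by simp
      finally show ?thesis .
    qed
    have "summable (\<lambda>n. prob (A n))"
    proof (rule bounded_imp_summable)
      fix N
      have "(\<Sum>n<Suc N. prob (A n)) = (\<Sum>n<Suc N. expectation (indicator (B n)))"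
        unfolding AB using B by simp
      also have "\<dots> = expectation (\<lambda>\<omega>. \<Sum>n<Suc N. indicator (B n) \<omega>)"
        using B by (intro Bochner_Integration.integral_sum[symmetric]) (auto simp: emeasure_eq_measure)
      also have "\<dots> \<le> expectation (\<lambda>\<omega>. Z 1 \<omega> / \<delta>)"
        using B count int by (intro integral_mono Bochner_Integration.integrable_sum) (auto simp: emeasure_eq_measure simp del: sum.lessThan_Suc)
      finally show "(\<Sum>n\<le>N. prob (A n)) \<le> expectation (\<lambda>\<omega>. Z 1 \<omega> / \<delta>)"
        by (simp only: lessThan_Suc_atMost)
    qed simp
    then have "AE \<omega> in M. \<forall>\<^sub>F n in sequentially. \<omega> \<in> space M - A n"
      using A by (intro borel_cantelli_AE1) (auto simp: emeasure_eq_measure)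
    then show ?thesis
      by eventually_elim (auto elim!: eventually_mono simp: A_def not_less)
  qed
  have "AE \<omega> in M. \<forall>i. \<forall>\<^sub>F n in sequentially. Z (Suc n) \<omega> \<le> inverse (real (Suc i)) * real (Suc n)"
    unfolding AE_all_countable by (intro allI step) simp
  then show ?thesis
  proof eventually_elim
    case (elim \<omega>)
    have "(\<lambda>n. Z (Suc n) \<omega> / real (Suc n)) \<longlonglongrightarrow> 0"
    proof (rule LIMSEQ_I)
      fix r :: real assume "0 < r"
      then obtain i where i: "inverse (real (Suc i)) < r"
        using reals_Archimedean by blast
      from elim obtain N where N: "\<And>n. n \<ge> N \<Longrightarrow> Z (Suc n) \<omega> \<le> inverse (real (Suc i)) * real (Suc n)"
        unfolding eventually_sequentially by blast
      have "norm (Z (Suc n) \<omega> / real (Suc n) - 0) < r" if "n \<ge> N" for n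
      proof -
        have "Z (Suc n) \<omega> / real (Suc n) \<le> inverse (real (Suc i))"
          using N[OF that] by (simp add: pos_divide_le_eq del: of_nat_Suc)
        with i nonneg[of "Suc n" \<omega>] show ?thesis by (simp del: of_nat_Suc)
      qed
      then show "\<exists>N. \<forall>n\<ge>N. norm (Z (Suc n) \<omega> / real (Suc n) - 0) < r" by blast
    qed
    then show ?case by (rule filterlim_sequentially_Suc[THEN iffD1, rotated -1])
  qed
qed

text \<open>
  The centred truncated squares are independent, centred and bounded by \<open>1\<close>, so
  \<open>AE_average_predictable_tendsto_0\<close> applies to them with the constant multiplier \<open>1\<close>.
\<close>
lemma AE_average_truncated_square:
  fixes V :: "nat \<Rightarrow> 'a \<Rightarrow> real"
  assumes ind: "indep_vars (\<lambda>_. borel) V {1..}"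
    and distr: "\<And>n. 1 \<le> n \<Longrightarrow> distr M borel (V n) = distr M borel (V 1)"
  shows "AE \<omega> in M. (\<lambda>n. (\<Sum>k=1..n. min ((V k \<omega>)\<^sup>2) 1) / real n)
    \<longlonglongrightarrow> expectation (\<lambda>\<omega>. min ((V 1 \<omega>)\<^sup>2) 1)"
proof -
  define m where "m = expectation (\<lambda>\<omega>. min ((V 1 \<omega>)\<^sup>2) 1)"
  define W where "W n \<omega> = min ((V n \<omega>)\<^sup>2) 1 - m" for n \<omega>
  have V_meas[measurable]: "V k \<in> borel_measurable M" if "1 \<le> k" for k
    using ind that by (auto simp: indep_vars_def)
  have W_meas[measurable]: "W k \<in> borel_measurable M" if "1 \<le> k" for k
    unfolding W_def using that by measurable
  have min_int: "integrable M (\<lambda>\<omega>. min ((V k \<omega>)\<^sup>2) 1)" if "1 \<le> k" for k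
    using V_meas[OF that] by (intro integrable_const_bound[where B=1]) auto
  have min_mean: "expectation (\<lambda>\<omega>. min ((V k \<omega>)\<^sup>2) 1) = m" if "1 \<le> k" for k
  proof -
    have "expectation (\<lambda>\<omega>. min ((V k \<omega>)\<^sup>2) 1) = (\<integral>x. min (x\<^sup>2) 1 \<partial>distr M borel (V k))"
      using that by (subst integral_distr) auto
    also have "\<dots> = (\<integral>x. min (x\<^sup>2) 1 \<partial>distr M borel (V 1))"
      by (simp only: distr[OF that])
    also have "\<dots> = m"
      unfolding m_def by (subst integral_distr) auto
    finally show ?thesis .
  qed
  have "0 \<le> m"
    unfolding m_def by (rule Bochner_Integration.integral_nonneg) simp
  have "m \<le> 1"
    unfolding m_def using integral_mono[OF min_int[of 1] integrable_const[of 1]] by (simp add: prob_space)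
  have W_bound: "(W k \<omega>)\<^sup>2 \<le> 1" for k \<omega>
  proof -
    have "0 \<le> min ((V k \<omega>)\<^sup>2) 1" "min ((V k \<omega>)\<^sup>2) 1 \<le> 1" by simp_all
    with \<open>0 \<le> m\<close> \<open>m \<le> 1\<close> have "\<bar>W k \<omega>\<bar> \<le> 1"
      unfolding W_def by linarith
    then show ?thesis by (simp add: abs_square_le_1)
  qed
  have sq_int: "integrable M (\<lambda>\<omega>. (W k \<omega>)\<^sup>2)" if "1 \<le> k" for k
    using W_meas[OF that] W_bound by (intro integrable_const_bound[where B=1]) auto
  have "AE \<omega> in M. (\<lambda>n. (\<Sum>k=1..n. 1 * W k \<omega>) / real n) \<longlonglongrightarrow> 0"
  proof (rule AE_average_predictable_tendsto_0[where Y="\<lambda>_ _. 1" and v=1 and C=1])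
    show "indep_vars (\<lambda>_. borel) W {1..}"
      unfolding W_def[abs_def] by (rule indep_vars_compose2[OF ind]) simp
    show "expectation (\<lambda>\<omega>. (W k \<omega>)\<^sup>2) \<le> 1" if "1 \<le> k" for k
      using integral_mono[OF sq_int[OF that] integrable_const[of 1]] W_bound by (simp add: prob_space)
    show "expectation (W k) = 0" if "1 \<le> k" for k
      unfolding W_def[abs_def] using min_int[OF that] min_mean[OF that] by (simp add: prob_space)
  qed (simp_all add: sq_int prob_space)
  then show ?thesis
  proof eventually_elim
    case (elim \<omega>)
    have "(\<lambda>n. (\<Sum>k=1..n. 1 * W k \<omega>) / real n + m) \<longlonglongrightarrow> 0 + m"
      by (intro tendsto_intros elim)
    moreover have "\<forall>\<^sub>F n in sequentially. (\<Sum>k=1..n. 1 * W k \<omega>) / real n + m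
        = (\<Sum>k=1..n. min ((V k \<omega>)\<^sup>2) 1) / real n"
      using eventually_gt_at_top[of 0]
      by eventually_elim (simp add: W_def sum_subtractf field_simps)
    ultimately show ?case
      unfolding m_def[symmetric] by (auto intro: Lim_transform_eventually)
  qed
qed

lemma expectation_truncated_square_pos:
  fixes f :: "'a \<Rightarrow> real"
  assumes [measurable]: "f \<in> borel_measurable M"
    and nz: "expectation (\<lambda>\<omega>. (f \<omega>)\<^sup>2) \<noteq> 0"
  shows "0 < expectation (\<lambda>\<omega>. min ((f \<omega>)\<^sup>2) 1)"
proof (rule ccontr)
  assume "\<not> ?thesis"
  moreover have int: "integrable M (\<lambda>\<omega>. min ((f \<omega>)\<^sup>2) 1)"
    by (intro integrable_const_bound[where B=1]) auto
  ultimately have "expectation (\<lambda>\<omega>. min ((f \<omega>)\<^sup>2) 1) = 0"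
    by (intro antisym Bochner_Integration.integral_nonneg) auto
  then have "AE \<omega> in M. min ((f \<omega>)\<^sup>2) 1 = 0"
    using integral_nonneg_eq_0_iff_AE[OF int] by simp
  then have "AE \<omega> in M. (f \<omega>)\<^sup>2 = 0"
    by eventually_elim (auto simp: min_def split: if_splits)
  then have "expectation (\<lambda>\<omega>. (f \<omega>)\<^sup>2) = 0"
    by (rule integral_eq_zero_AE)
  with nz show False by simp
qed

text \<open>
  The process started from zero is a function of the past with bounded second moments, and the two
  responses to the initial values are bounded deterministic sequences. The strong law for predictable
  multipliers covers each of the three, and the initial values enter only as factors that are
  constant in \<open>n\<close>, so any dependence between them and \<open>V\<close> is harmless.
\<close>
lemma AE_average_regressor_innovation_tendsto_0:
  fixes V X \<epsilon> :: "nat \<Rightarrow> 'a \<Rightarrow> real"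
  assumes \<theta>: "\<bar>\<theta>\<bar> < 1" and \<rho>: "\<bar>\<rho>\<bar> < 1"
    and ind: "indep_vars (\<lambda>_. borel) V {1..}"
    and V_int: "\<And>k. 1 \<le> k \<Longrightarrow> integrable M (\<lambda>\<omega>. (V k \<omega>)\<^sup>2)"
    and V_le: "\<And>k. 1 \<le> k \<Longrightarrow> expectation (\<lambda>\<omega>. (V k \<omega>)\<^sup>2) \<le> v"
    and V_mean: "\<And>k. 1 \<le> k \<Longrightarrow> expectation (V k) = 0"
    and X: "\<And>n \<omega>. 1 \<le> n \<Longrightarrow> \<omega> \<in> space M \<Longrightarrow> X n \<omega> = \<theta> * X (n - 1) \<omega> + \<epsilon> n \<omega>"
    and \<epsilon>: "\<And>n \<omega>. 1 \<le> n \<Longrightarrow> \<omega> \<in> space M \<Longrightarrow> \<epsilon> n \<omega> = \<rho> * \<epsilon> (n - 1) \<omega> + V n \<omega>"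
  shows "AE \<omega> in M. (\<lambda>n. (\<Sum>k=1..n. X (k - 1) \<omega> * V k \<omega>) / real n) \<longlonglongrightarrow> 0"
proof -
  have V_meas: "V k \<in> borel_measurable M" if "1 \<le> k" for k
    using ind that by (auto simp: indep_vars_def)
  \<comment> \<open>\<open>E\<close> and \<open>U\<close> are the noise and the process started from zero, \<open>s\<close> is the response of \<open>X\<close> to \<open>\<epsilon> 0 = 1\<close>\<close>
  define E where "E k \<omega> = ar1 \<rho> 0 (\<lambda>k. V k \<omega>) k" for k \<omega>
  define U where "U k \<omega> = ar1 \<theta> 0 (\<lambda>k. E k \<omega>) k" for k \<omega>
  define s where "s = ar1 \<theta> 0 (\<lambda>k. \<rho> ^ k)"
  have decomp: "X k \<omega> = U k \<omega> + \<epsilon> 0 \<omega> * s k + X 0 \<omega> * \<theta> ^ k" if "\<omega> \<in> space M" for k \<omega>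
  proof -
    have "\<epsilon> n \<omega> = E n \<omega> + \<epsilon> 0 \<omega> * \<rho> ^ n" for n
    proof -
      have "\<epsilon> n \<omega> = ar1 \<rho> (\<epsilon> 0 \<omega>) (\<lambda>n. V n \<omega>) n"
        by (rule ar1_unique[of "\<lambda>n. \<epsilon> n \<omega>"]) (rule \<epsilon>[OF _ that])
      then show ?thesis
        using ar1_superposition[of \<rho> "\<epsilon> 0 \<omega>" "\<lambda>n. V n \<omega>" 0 "\<lambda>n. 0" n]
        unfolding E_def by simp
    qed
    then have \<epsilon>_eq: "(\<lambda>n. \<epsilon> n \<omega>) = (\<lambda>n. E n \<omega> + \<epsilon> 0 \<omega> * \<rho> ^ n)"
      by (rule ext)
    have "X k \<omega> = ar1 \<theta> (X 0 \<omega>) (\<lambda>n. \<epsilon> n \<omega>) k"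
      by (rule ar1_unique[of "\<lambda>n. X n \<omega>"]) (rule X[OF _ that])
    also have "\<dots> = ar1 \<theta> (X 0 \<omega>) (\<lambda>n. E n \<omega> + \<epsilon> 0 \<omega> * \<rho> ^ n) k"
      by (subst \<epsilon>_eq) (rule refl)
    finally show ?thesis
      unfolding ar1_superposition U_def s_def .
  qed

  have E_past: "E k \<in> borel_measurable (past M V k)" for k
  proof (induction k)
    case (Suc k)
    have "(\<lambda>\<omega>. \<rho> * E k \<omega> + V (Suc k) \<omega>) \<in> borel_measurable (past M V (Suc k))"
      by (intro borel_measurable_add borel_measurable_times borel_measurable_const
          borel_measurable_past borel_measurable_past_mono[OF Suc]) auto
    then show ?case by (simp add: E_def[abs_def])
  qed (simp add: E_def[abs_def])
  have U_past: "U k \<in> borel_measurable (past M V k)" for k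
  proof (induction k)
    case (Suc k)
    have "(\<lambda>\<omega>. \<theta> * U k \<omega> + E (Suc k) \<omega>) \<in> borel_measurable (past M V (Suc k))"
      by (intro borel_measurable_add borel_measurable_times borel_measurable_const
          E_past borel_measurable_past_mono[OF Suc]) auto
    then show ?case by (simp add: U_def[abs_def])
  qed (simp add: U_def[abs_def])
  have E_moment: "E k \<in> borel_measurable M \<and> integrable M (\<lambda>\<omega>. (E k \<omega>)\<^sup>2) \<and>
      expectation (\<lambda>\<omega>. (E k \<omega>)\<^sup>2) \<le> v / (1 - \<bar>\<rho>\<bar>)\<^sup>2" for k
    unfolding E_def[abs_def] by (rule ar1_second_moment[OF \<rho> V_meas V_int V_le])
  have U_moment: "U k \<in> borel_measurable M \<and> integrable M (\<lambda>\<omega>. (U k \<omega>)\<^sup>2) \<and>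
      expectation (\<lambda>\<omega>. (U k \<omega>)\<^sup>2) \<le> v / (1 - \<bar>\<rho>\<bar>)\<^sup>2 / (1 - \<bar>\<theta>\<bar>)\<^sup>2" for k
    unfolding U_def[abs_def] using E_moment by (intro ar1_second_moment[OF \<theta>]) auto
  note average = AE_average_predictable_tendsto_0[OF ind V_int V_le V_mean]
  have AE_U: "AE \<omega> in M. (\<lambda>n. (\<Sum>k=1..n. U (k - 1) \<omega> * V k \<omega>) / real n) \<longlonglongrightarrow> 0"
    using U_moment by (intro average U_past) auto
  have AE_const: "AE \<omega> in M. (\<lambda>n. (\<Sum>k=1..n. c (k - 1) * V k \<omega>) / real n) \<longlonglongrightarrow> 0"
    if "\<And>k. \<bar>c k\<bar> \<le> C" for c :: "nat \<Rightarrow> real" and C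
    using that abs_le_square_iff[of _ C] order_trans[OF abs_ge_zero that]
    by (intro average[where C="C\<^sup>2"]) (auto simp: prob_space)
  have AE_s: "AE \<omega> in M. (\<lambda>n. (\<Sum>k=1..n. s (k - 1) * V k \<omega>) / real n) \<longlonglongrightarrow> 0"
  proof (rule AE_const)
    show "\<bar>s k\<bar> \<le> 1 / (1 - \<bar>\<theta>\<bar>)" for k
      unfolding s_def using \<rho> by (intro ar1_bounded[OF \<theta>]) (simp add: power_abs power_le_one)
  qed
  have AE_\<theta>: "AE \<omega> in M. (\<lambda>n. (\<Sum>k=1..n. \<theta> ^ (k - 1) * V k \<omega>) / real n) \<longlonglongrightarrow> 0"
  proof (rule AE_const)
    show "\<bar>\<theta> ^ k\<bar> \<le> 1" for k
      using \<theta> by (simp add: power_abs power_le_one)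
  qed
  from AE_U AE_s AE_\<theta> AE_space show ?thesis
  proof eventually_elim
    case (elim \<omega>)
    have "(\<Sum>k=1..n. X (k - 1) \<omega> * V k \<omega>)
        = (\<Sum>k=1..n. (U (k - 1) \<omega> + \<epsilon> 0 \<omega> * s (k - 1) + X 0 \<omega> * \<theta> ^ (k - 1)) * V k \<omega>)" for n
      by (intro sum.cong refl arg_cong2[where f="(*)"] decomp elim)
    then have "(\<Sum>k=1..n. X (k - 1) \<omega> * V k \<omega>) / real n
        = (\<Sum>k=1..n. U (k - 1) \<omega> * V k \<omega>) / real n
          + \<epsilon> 0 \<omega> * ((\<Sum>k=1..n. s (k - 1) * V k \<omega>) / real n)
          + X 0 \<omega> * ((\<Sum>k=1..n. \<theta> ^ (k - 1) * V k \<omega>) / real n)" for n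
      by (simp add: distrib_right sum.distrib sum_distrib_left add_divide_distrib mult.assoc)
    moreover have "(\<lambda>n. (\<Sum>k=1..n. U (k - 1) \<omega> * V k \<omega>) / real n
          + \<epsilon> 0 \<omega> * ((\<Sum>k=1..n. s (k - 1) * V k \<omega>) / real n)
          + X 0 \<omega> * ((\<Sum>k=1..n. \<theta> ^ (k - 1) * V k \<omega>) / real n)) \<longlonglongrightarrow> 0 + \<epsilon> 0 \<omega> * 0 + X 0 \<omega> * 0"
      by (intro tendsto_intros elim)
    ultimately show ?case by simp
  qed
qed

end

section \<open>Almost sure limit of the estimator\<close>

theorem theorem2p1:
  fixes M :: "'a measure"
    and V X \<epsilon> :: "nat \<Rightarrow> 'a \<Rightarrow> real"
    and \<theta> \<rho> \<sigma> :: real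
  assumes "prob_space M"
    and "\<bar>\<theta>\<bar> < 1" and "\<bar>\<rho>\<bar> < 1"
    and "iid_from_1 M V"
    and "\<And>n. n \<ge> 1 \<Longrightarrow> integrable M (\<lambda>\<omega>. (V n \<omega>)\<^sup>2)"
    and "\<And>n. n \<ge> 1 \<Longrightarrow> prob_space.expectation M (V n) = 0"
    and "\<And>n. n \<ge> 1 \<Longrightarrow> prob_space.variance M (V n) = \<sigma>\<^sup>2"
    and "\<sigma>\<^sup>2 > 0"
    and "X 0 \<in> borel_measurable M" and "\<epsilon> 0 \<in> borel_measurable M"
    and "\<And>n \<omega>. n \<ge> 1 \<Longrightarrow> \<omega> \<in> space M \<Longrightarrow> X n \<omega> = \<theta> * X (n - 1) \<omega> + \<epsilon> n \<omega>"
    and "\<And>n \<omega>. n \<ge> 1 \<Longrightarrow> \<omega> \<in> space M \<Longrightarrow> \<epsilon> n \<omega> = \<rho> * \<epsilon> (n - 1) \<omega> + V n \<omega>"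
  shows "AE \<omega> in M. (\<lambda>n. ls_estimator (\<lambda>k. X k \<omega>) n) \<longlonglongrightarrow> (\<theta> + \<rho>) / (1 + \<theta> * \<rho>)"
proof -
  interpret prob_space M by fact
  have ind: "indep_vars (\<lambda>_. borel) V {1..}"
    using assms(4) unfolding iid_from_1_def by (rule conjunct1)
  have distr: "distr M borel (V n) = distr M borel (V 1)" if "1 \<le> n" for n
    using assms(4) that unfolding iid_from_1_def by blast
  have V_meas: "V k \<in> borel_measurable M" if "1 \<le> k" for k
    using ind that by (auto simp: indep_vars_def)
  have second_moment: "expectation (\<lambda>\<omega>. (V n \<omega>)\<^sup>2) = \<sigma>\<^sup>2" if "1 \<le> n" for n
    using assms(7)[OF that] unfolding assms(6)[OF that] by simp
  have sq_distr: "distr M borel (\<lambda>\<omega>. (V n \<omega>)\<^sup>2) = distr M borel (\<lambda>\<omega>. (V 1 \<omega>)\<^sup>2)" if "1 \<le> n" for n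
  proof -
    have "distr M borel (\<lambda>\<omega>. (V k \<omega>)\<^sup>2) = distr (distr M borel (V k)) borel (\<lambda>x. x\<^sup>2)" if "1 \<le> k" for k
      using V_meas[OF that] by (subst distr_distr) (auto simp: comp_def)
    from this[OF that] this[of 1] show ?thesis
      by (simp only: distr[OF that] le_refl)
  qed
  have trunc_pos: "0 < expectation (\<lambda>\<omega>. min ((V 1 \<omega>)\<^sup>2) 1)"
    using assms(8) second_moment[of 1] by (intro expectation_truncated_square_pos V_meas) auto
  have "AE \<omega> in M. (\<lambda>n. (V n \<omega>)\<^sup>2 / real n) \<longlonglongrightarrow> 0"
    using V_meas assms(5) by (intro AE_div_index_tendsto_0 sq_distr) auto
  moreover have "AE \<omega> in M. (\<lambda>n. (\<Sum>k=1..n. X (k - 1) \<omega> * V k \<omega>) / real n) \<longlonglongrightarrow> 0"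
    by (rule AE_average_regressor_innovation_tendsto_0[OF assms(2,3) ind assms(5) _ assms(6,11,12),
          where v="\<sigma>\<^sup>2"])
      (simp_all add: second_moment)
  moreover have "AE \<omega> in M. (\<lambda>n. (\<Sum>k=1..n. min ((V k \<omega>)\<^sup>2) 1) / real n)
      \<longlonglongrightarrow> expectation (\<lambda>\<omega>. min ((V 1 \<omega>)\<^sup>2) 1)"
    by (rule AE_average_truncated_square[OF ind distr])
  moreover have "AE \<omega> in M. \<omega> \<in> space M"
    by (rule AE_space)
  ultimately show ?thesis
  proof eventually_elim
    case (elim \<omega>)
    show ?case
    proof (rule ls_estimator_tendsto[where e="\<lambda>k. \<epsilon> k \<omega>" and v="\<lambda>k. V k \<omega>"])
      show "X n \<omega> = \<theta> * X (n - 1) \<omega> + \<epsilon> n \<omega>" if "1 \<le> n" for n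
        by (rule assms(11)[OF that elim(4)])
      show "\<epsilon> n \<omega> = \<rho> * \<epsilon> (n - 1) \<omega> + V n \<omega>" if "1 \<le> n" for n
        by (rule assms(12)[OF that elim(4)])
    qed (fact assms(2,3) trunc_pos elim)+
  qed
qed

end
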